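(* Let $(T,+,\Gamma)$ be a commutative ternary $\Gamma$-semiring. Every radical ideal of $T$ is semiprime, and every semiprime ideal $Q$ of $T$ equals its own radical, i.e. $Q=\sqrt{Q}$.
   Context: A ternary $\Gamma$-semiring $(T,+,\Gamma)$ consists of a set $T$, an addition $+$, a set $\Gamma$ of parameters, and a map $T\times\Gamma\times T\times\Gamma\times T\to T$, $(a,\alpha,b,\beta,c)\mapsto a_{\alpha}b_{\beta}c$, such that: $(T,+)$ is a commutative semigroup with identity element $0$; $(a_{\alpha}b_{\beta}c)_{\gamma}d_{\delta}e=a_{\alpha}b_{\beta}(c_{\gamma}d_{\delta}e)$; the product is additive in each of its three $T$-variables; and $0_{\alpha}b_{\beta}c=a_{\alpha}0_{\beta}c=a_{\alpha}b_{\beta}0=0$. It is commutative if $a_{\alpha}b_{\beta}c=b_{\beta}a_{\alpha}c=c_{\alpha}b_{\beta}a$ for all $a,b,c\in T$, $\alpha,\beta\in\Gamma$. An ideal is a nonempty $I\subseteq T$ closed under $+$ such that $a_{\alpha}b_{\beta}c\in I$ whenever at least one of $a,b,c\in T$ lies in $I$ (all $\alpha,\beta\in\Gamma$). An ideal $P\ne T$ is prime if for all $a,b,c\in T$, $\alpha,\beta\in\Gamma$: $a_{\alpha}b_{\beta}c\in P$ implies $a\in P$ or $b\in P$ or $c\in P$. An ideal $Q\neq T$ is semiprime if for all $a\in T$, $\alpha,\beta\in\Gamma$: $a_{\alpha}a_{\beta}a\in Q$ implies $a\in Q$. The (prime) radical of an ideal $I$ is $\sqrt{I}=\bigcap\{P\mid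 P\text{ a prime ideal of }T,\ I\subseteq P\}$. An ideal $I$ is a radical ideal if $I=\sqrt I$.
   Formalization: The first claim is stated for radical ideals I ≠ T: the improper ideal T equals its own radical (no prime ideal contains it, so the intersection is empty and equals T), but semiprime ideals are proper by definition, so the literal claim fails for I = T only. *)

theory Defs
  imports "HOL-Algebra.Congruence"
begin

record ('a, 'g) ternary_gamma = "'a partial_object" +
  tzero :: 'a
  tadd :: "'a \<Rightarrow> 'a \<Rightarrow> 'a"
  params :: "'g set"
  tprod :: "'a \<Rightarrow> 'g \<Rightarrow> 'a \<Rightarrow> 'g \<Rightarrow> 'a \<Rightarrow> 'a"

locale ternary_gamma_semiring =
  fixes T :: "('a, 'g, 'm) ternary_gamma_scheme"
  assumes tzero_closed: "tzero T \<in> carrier T"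
    and tadd_closed: "\<lbrakk>a \<in> carrier T; b \<in> carrier T\<rbrakk> \<Longrightarrow> tadd T a b \<in> carrier T"
    and tadd_assoc: "\<lbrakk>a \<in> carrier T; b \<in> carrier T; c \<in> carrier T\<rbrakk>
      \<Longrightarrow> tadd T (tadd T a b) c = tadd T a (tadd T b c)"
    and tadd_comm: "\<lbrakk>a \<in> carrier T; b \<in> carrier T\<rbrakk> \<Longrightarrow> tadd T a b = tadd T b a"
    and tadd_tzero: "a \<in> carrier T \<Longrightarrow> tadd T a (tzero T) = a"
    and tprod_closed: "\<lbrakk>a \<in> carrier T; b \<in> carrier T; c \<in> carrier T; \<alpha> \<in> params T; \<beta> \<in> params T\<rbrakk>
      \<Longrightarrow> tprod T a \<alpha> b \<beta> c \<in> carrier T"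
    and tprod_assoc: "\<lbrakk>a \<in> carrier T; b \<in> carrier T; c \<in> carrier T; d \<in> carrier T; e \<in> carrier T;
        \<alpha> \<in> params T; \<beta> \<in> params T; \<gamma> \<in> params T; \<delta> \<in> params T\<rbrakk>
      \<Longrightarrow> tprod T (tprod T a \<alpha> b \<beta> c) \<gamma> d \<delta> e = tprod T a \<alpha> b \<beta> (tprod T c \<gamma> d \<delta> e)"
    and tprod_add1: "\<lbrakk>a \<in> carrier T; a' \<in> carrier T; b \<in> carrier T; c \<in> carrier T;
        \<alpha> \<in> params T; \<beta> \<in> params T\<rbrakk>
      \<Longrightarrow> tprod T (tadd T a a') \<alpha> b \<beta> c = tadd T (tprod T a \<alpha> b \<beta> c) (tprod T a' \<alpha> b \<beta> c)"
    and tprod_add2: "\<lbrakk>a \<in> carrier T; b \<in> carrier T; b' \<in> carrier T; c \<in> carrier T;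
        \<alpha> \<in> params T; \<beta> \<in> params T\<rbrakk>
      \<Longrightarrow> tprod T a \<alpha> (tadd T b b') \<beta> c = tadd T (tprod T a \<alpha> b \<beta> c) (tprod T a \<alpha> b' \<beta> c)"
    and tprod_add3: "\<lbrakk>a \<in> carrier T; b \<in> carrier T; c \<in> carrier T; c' \<in> carrier T;
        \<alpha> \<in> params T; \<beta> \<in> params T\<rbrakk>
      \<Longrightarrow> tprod T a \<alpha> b \<beta> (tadd T c c') = tadd T (tprod T a \<alpha> b \<beta> c) (tprod T a \<alpha> b \<beta> c')"
    and tprod_zero1: "\<lbrakk>b \<in> carrier T; c \<in> carrier T; \<alpha> \<in> params T; \<beta> \<in> params T\<rbrakk>
      \<Longrightarrow> tprod T (tzero T) \<alpha> b \<beta> c = tzero T"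
    and tprod_zero2: "\<lbrakk>a \<in> carrier T; c \<in> carrier T; \<alpha> \<in> params T; \<beta> \<in> params T\<rbrakk>
      \<Longrightarrow> tprod T a \<alpha> (tzero T) \<beta> c = tzero T"
    and tprod_zero3: "\<lbrakk>a \<in> carrier T; b \<in> carrier T; \<alpha> \<in> params T; \<beta> \<in> params T\<rbrakk>
      \<Longrightarrow> tprod T a \<alpha> b \<beta> (tzero T) = tzero T"

locale comm_ternary_gamma_semiring = ternary_gamma_semiring +
  assumes tprod_comm12: "\<lbrakk>a \<in> carrier T; b \<in> carrier T; c \<in> carrier T; \<alpha> \<in> params T; \<beta> \<in> params T\<rbrakk>
      \<Longrightarrow> tprod T a \<alpha> b \<beta> c = tprod T b \<beta> a \<alpha> c"
    and tprod_comm13: "\<lbrakk>a \<in> carrier T; b \<in> carrier T; c \<in> carrier T; \<alpha> \<in> params T; \<beta> \<in> params T\<rbrakk>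
      \<Longrightarrow> tprod T a \<alpha> b \<beta> c = tprod T c \<alpha> b \<beta> a"

definition tg_ideal :: "('a, 'g, 'm) ternary_gamma_scheme \<Rightarrow> 'a set \<Rightarrow> bool" where
  "tg_ideal T I \<longleftrightarrow>
     I \<subseteq> carrier T \<and> I \<noteq> {} \<and>
     (\<forall>a\<in>I. \<forall>b\<in>I. tadd T a b \<in> I) \<and>
     (\<forall>a\<in>carrier T. \<forall>b\<in>carrier T. \<forall>c\<in>carrier T. \<forall>\<alpha>\<in>params T. \<forall>\<beta>\<in>params T.
        a \<in> I \<or> b \<in> I \<or> c \<in> I \<longrightarrow> tprod T a \<alpha> b \<beta> c \<in> I)"

definition tg_prime :: "('a, 'g, 'm) ternary_gamma_scheme \<Rightarrow> 'a set \<Rightarrow> bool" where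
  "tg_prime T P \<longleftrightarrow>
     tg_ideal T P \<and> P \<noteq> carrier T \<and>
     (\<forall>a\<in>carrier T. \<forall>b\<in>carrier T. \<forall>c\<in>carrier T. \<forall>\<alpha>\<in>params T. \<forall>\<beta>\<in>params T.
        tprod T a \<alpha> b \<beta> c \<in> P \<longrightarrow> a \<in> P \<or> b \<in> P \<or> c \<in> P)"

definition tg_semiprime :: "('a, 'g, 'm) ternary_gamma_scheme \<Rightarrow> 'a set \<Rightarrow> bool" where
  "tg_semiprime T Q \<longleftrightarrow>
     tg_ideal T Q \<and> Q \<noteq> carrier T \<and>
     (\<forall>a\<in>carrier T. \<forall>\<alpha>\<in>params T. \<forall>\<beta>\<in>params T. tprod T a \<alpha> a \<beta> a \<in> Q \<longrightarrow> a \<in> Q)"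

(* The intersection is taken inside the carrier, so it is the whole carrier
   when no prime ideal contains I. *)
definition tg_radical :: "('a, 'g, 'm) ternary_gamma_scheme \<Rightarrow> 'a set \<Rightarrow> 'a set" where
  "tg_radical T I = carrier T \<inter> \<Inter>{P. tg_prime T P \<and> I \<subseteq> P}"

definition tg_radical_ideal :: "('a, 'g, 'm) ternary_gamma_scheme \<Rightarrow> 'a set \<Rightarrow> bool" where
  "tg_radical_ideal T I \<longleftrightarrow> tg_ideal T I \<and> I = tg_radical T I"

(* The improper ideal is always a radical ideal and, as semiprime ideals are
   proper by definition, never semiprime. *)
lemma (in ternary_gamma_semiring) carrier_radical_ideal_not_semiprime:
  "tg_radical_ideal T (carrier T)" "\<not> tg_semiprime T (carrier T)"
  using tzero_closed tadd_closed tprod_closed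
  by (auto simp: tg_radical_ideal_def tg_radical_def tg_ideal_def tg_prime_def tg_semiprime_def)

end

(* To separate a semiprime ideal Q from a point a outside it, take P maximal (Zorn) among the
   semiprime ideals that contain Q and avoid a.  For y, z and parameters \<alpha>, \<beta>, the colon
   {t. t \<alpha> y \<beta> z \<in> P} is an ideal containing P which again satisfies the semiprime implication, so by
   maximality it is P or contains a.  If a product x \<alpha> y \<beta> z lies in P but no factor does, then applying
   this to one factor after another replaces x, y and z by a; so the cube a \<beta> a \<alpha> a lies in P,
   hence a does, a contradiction. *)

theory Submission
  imports Defs
begin

section \<open>Ideals and unions of chains\<close>

lemma tg_idealD:
  assumes "tg_ideal T I"
  shows "I \<subseteq> carrier T" "I \<noteq> {}"
    and "\<lbrakk>a \<in> I; b \<in> I\<rbrakk> \<Longrightarrow> tadd T a b \<in> I"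
    and "\<lbrakk>a \<in> carrier T; b \<in> carrier T; c \<in> carrier T; \<alpha> \<in> params T; \<beta> \<in> params T;
          a \<in> I \<or> b \<in> I \<or> c \<in> I\<rbrakk> \<Longrightarrow> tprod T a \<alpha> b \<beta> c \<in> I"
  using assms unfolding tg_ideal_def by auto

text \<open>Two summands from the union lie in a common member because members are comparable;
  absorption involves a single member only.\<close>

lemma tg_ideal_Union_chain:
  assumes "subset.chain \<A> \<C>" "\<C> \<noteq> {}" and ideals: "\<And>I. I \<in> \<A> \<Longrightarrow> tg_ideal T I"
  shows "tg_ideal T (\<Union>\<C>)"
proof -
  have mem: "tg_ideal T I" if "I \<in> \<C>" for I
    using assms that unfolding subset_chain_def by blast
  have "tadd T a b \<in> \<Union>\<C>" if ab: "a \<in> \<Union>\<C>" "b \<in> \<Union>\<C>" for a b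
  proof -
    obtain I J where I: "I \<in> \<C>" "a \<in> I" and J: "J \<in> \<C>" "b \<in> J"
      using ab by blast
    have "I \<subseteq> J \<or> J \<subseteq> I"
      using assms(1) I(1) J(1) unfolding subset_chain_def by blast
    then show ?thesis
      using I(2) J(2) tg_idealD(3)[OF mem[OF I(1)]] tg_idealD(3)[OF mem[OF J(1)]] I(1) J(1)
      by (meson UnionI subsetD)
  qed
  moreover have "\<Union>\<C> \<subseteq> carrier T"
    using mem tg_idealD(1) by blast
  moreover have "\<Union>\<C> \<noteq> {}"
    using mem tg_idealD(2) assms(2) by blast
  moreover have "tprod T a \<alpha> b \<beta> c \<in> \<Union>\<C>"
    if car: "a \<in> carrier T" "b \<in> carrier T" "c \<in> carrier T" "\<alpha> \<in> params T" "\<beta> \<in> params T"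
      and mem_Un: "a \<in> \<Union>\<C> \<or> b \<in> \<Union>\<C> \<or> c \<in> \<Union>\<C>" for a b c \<alpha> \<beta>
  proof -
    obtain I where "I \<in> \<C>" "a \<in> I \<or> b \<in> I \<or> c \<in> I"
      using mem_Un by blast
    then show ?thesis
      using tg_idealD(4)[OF mem car] by blast
  qed
  ultimately show ?thesis
    unfolding tg_ideal_def by blast
qed

text \<open>A cube in the union already lies in one member, which then contains its root. Properness
  is a hypothesis because a union of proper ideals may exhaust the carrier.\<close>

lemma tg_semiprime_Union_chain:
  assumes "subset.chain \<A> \<C>" "\<C> \<noteq> {}"
    and semiprimes: "\<And>I. I \<in> \<A> \<Longrightarrow> tg_semiprime T I" and "\<Union>\<C> \<noteq> carrier T"
  shows "tg_semiprime T (\<Union>\<C>)"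
proof -
  have "tg_ideal T (\<Union>\<C>)"
    using assms(1,2)
    by (rule tg_ideal_Union_chain) (use semiprimes in \<open>simp add: tg_semiprime_def\<close>)
  moreover have "tg_semiprime T I" if "I \<in> \<C>" for I
    using assms(1) semiprimes that unfolding subset_chain_def by blast
  ultimately show ?thesis
    using assms(4) unfolding tg_semiprime_def by (meson UnionE UnionI)
qed

section \<open>Colon ideals\<close>

definition tg_colon ::
    "('a, 'g, 'm) ternary_gamma_scheme \<Rightarrow> 'a set \<Rightarrow> 'g \<Rightarrow> 'a \<Rightarrow> 'g \<Rightarrow> 'a \<Rightarrow> 'a set" where
  "tg_colon T I \<alpha> y \<beta> z = {t \<in> carrier T. tprod T t \<alpha> y \<beta> z \<in> I}"

lemma tg_subset_colon:
  assumes "tg_ideal T I" "y \<in> carrier T" "z \<in> carrier T" "\<alpha> \<in> params T" "\<beta> \<in> params T"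
  shows "I \<subseteq> tg_colon T I \<alpha> y \<beta> z"
  using assms tg_idealD(1,4)[OF assms(1)] unfolding tg_colon_def by blast

context comm_ternary_gamma_semiring
begin

text \<open>Commutativity moves \<open>t\<close> to the last slot, where associativity passes it on
  to \<open>y\<close> and \<open>z\<close>. Hence the map sending \<open>t\<close> to
  \<open>tprod T t \<alpha> y \<beta> z\<close> can be pulled out of the first slot of a
  product.\<close>

lemma tprod_interchange:
  assumes "t \<in> carrier T" "u \<in> carrier T" "v \<in> carrier T" "y \<in> carrier T" "z \<in> carrier T"
    and "\<alpha> \<in> params T" "\<beta> \<in> params T" "\<gamma> \<in> params T" "\<delta> \<in> params T"
  shows "tprod T (tprod T t \<gamma> u \<delta> v) \<alpha> y \<beta> z = tprod T (tprod T t \<alpha> y \<beta> z) \<gamma> u \<delta> v"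
proof -
  have "tprod T (tprod T t \<gamma> u \<delta> v) \<alpha> y \<beta> z = tprod T (tprod T v \<gamma> u \<delta> t) \<alpha> y \<beta> z"
    using assms tprod_comm13 by simp
  also have "\<dots> = tprod T v \<gamma> u \<delta> (tprod T t \<alpha> y \<beta> z)"
    using assms tprod_assoc by simp
  also have "\<dots> = tprod T (tprod T t \<alpha> y \<beta> z) \<gamma> u \<delta> v"
    using assms tprod_comm13 tprod_closed by simp
  finally show ?thesis .
qed

text \<open>Each of the three factors \<open>w\<close> releases one application of the map with
  \<open>y\<close> and \<open>z\<close>, once commutativity has brought it to the first
  slot.\<close>

lemma tprod_cube_colon:
  assumes "t \<in> carrier T" "y \<in> carrier T" "z \<in> carrier T"
    and "\<alpha> \<in> params T" "\<beta> \<in> params T" "\<gamma> \<in> params T" "\<delta> \<in> params T"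
  defines "w \<equiv> tprod T t \<alpha> y \<beta> z"
  shows "tprod T w \<gamma> w \<delta> w =
    tprod T (tprod T (tprod T (tprod T t \<gamma> t \<delta> t) \<alpha> y \<beta> z) \<alpha> y \<beta> z) \<alpha> y \<beta> z"
proof -
  have w: "w \<in> carrier T"
    using assms(1-7) tprod_closed unfolding w_def by simp
  have pull: "tprod T w \<gamma>' u \<delta>' v = tprod T (tprod T t \<gamma>' u \<delta>' v) \<alpha> y \<beta> z"
    if "u \<in> carrier T" "v \<in> carrier T" "\<gamma>' \<in> params T" "\<delta>' \<in> params T" for u v \<gamma>' \<delta>'
    unfolding w_def using tprod_interchange[of t y z u v \<gamma>' \<delta>' \<alpha> \<beta>] assms(1-7) that by simp
  have "tprod T w \<gamma> w \<delta> w = tprod T (tprod T t \<gamma> w \<delta> w) \<alpha> y \<beta> z"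
    using pull w assms(6,7) by simp
  also have "tprod T t \<gamma> w \<delta> w = tprod T w \<gamma> w \<delta> t"
    using tprod_comm13 w assms(1,6,7) by simp
  also have "\<dots> = tprod T (tprod T t \<gamma> w \<delta> t) \<alpha> y \<beta> z"
    using pull w assms(1,6,7) by simp
  \<comment> \<open>Moving the middle factor to the front interchanges \<open>\<gamma>\<close> and
    \<open>\<delta>\<close>; the order is restored at the end by swapping two equal factors
    \<open>t\<close>.\<close>
  also have "tprod T t \<gamma> w \<delta> t = tprod T w \<delta> t \<gamma> t"
    using tprod_comm12[of t w t \<gamma> \<delta>] w assms(1,6,7) by simp
  also have "\<dots> = tprod T (tprod T t \<delta> t \<gamma> t) \<alpha> y \<beta> z"
    using pull assms(1,6,7) by simp
  also have "tprod T t \<delta> t \<gamma> t = tprod T t \<gamma> t \<delta> t"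
    using tprod_comm12[of t t t \<delta> \<gamma>] assms(1,6,7) by simp
  finally show ?thesis .
qed

lemma tg_ideal_colon:
  assumes I: "tg_ideal T I" and yz: "y \<in> carrier T" "z \<in> carrier T"
    and par: "\<alpha> \<in> params T" "\<beta> \<in> params T"
  shows "tg_ideal T (tg_colon T I \<alpha> y \<beta> z)" (is "tg_ideal T ?C")
proof -
  \<comment> \<open>Absorption is proved for the first slot, by interchange; commutativity carries
    the other two slots to it.\<close>
  have absorb: "tprod T t \<gamma> u \<delta> v \<in> ?C"
    if "t \<in> ?C" "u \<in> carrier T" "v \<in> carrier T" "\<gamma> \<in> params T" "\<delta> \<in> params T" for t u v \<gamma> \<delta>
  proof -
    have t: "t \<in> carrier T" "tprod T t \<alpha> y \<beta> z \<in> I"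
      using that(1) by (auto simp: tg_colon_def)
    have "tprod T (tprod T t \<gamma> u \<delta> v) \<alpha> y \<beta> z = tprod T (tprod T t \<alpha> y \<beta> z) \<gamma> u \<delta> v"
      using tprod_interchange t(1) that yz par by simp
    also have "\<dots> \<in> I"
      using tg_idealD(4)[OF I] tprod_closed t that yz par by simp
    finally show ?thesis
      using tprod_closed t that by (simp add: tg_colon_def)
  qed
  have "tprod T a \<gamma> b \<delta> c \<in> ?C"
    if car: "a \<in> carrier T" "b \<in> carrier T" "c \<in> carrier T" "\<gamma> \<in> params T" "\<delta> \<in> params T"
      and "a \<in> ?C \<or> b \<in> ?C \<or> c \<in> ?C" for a b c \<gamma> \<delta>
    using that(6)
  proof (elim disjE)
    assume "b \<in> ?C"
    then show ?thesis
      using absorb tprod_comm12[of a b c \<gamma> \<delta>] car by simp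
  next
    assume "c \<in> ?C"
    then show ?thesis
      using absorb tprod_comm13[of a b c \<gamma> \<delta>] car by simp
  qed (use absorb car in blast)
  moreover have "tadd T a b \<in> ?C" if "a \<in> ?C" "b \<in> ?C" for a b
    using that tadd_closed tprod_add1 tg_idealD(3)[OF I] yz par by (simp add: tg_colon_def)
  moreover have "?C \<noteq> {}"
    using tg_subset_colon[OF I yz par] tg_idealD(2)[OF I] by blast
  moreover have "?C \<subseteq> carrier T"
    by (auto simp: tg_colon_def)
  ultimately show ?thesis
    unfolding tg_ideal_def by blast
qed

text \<open>A cube in the colon gives one application of the map with \<open>y\<close> and
  \<open>z\<close> that lands in \<open>Q\<close>. Absorption permits two more, which makes the
  value the cube of \<open>tprod T t \<alpha> y \<beta> z\<close>. Properness can fail, for instance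
  when \<open>y\<close> lies in \<open>Q\<close>.\<close>

lemma tg_semiprime_colon:
  assumes Q: "tg_semiprime T Q" and yz: "y \<in> carrier T" "z \<in> carrier T"
    and par: "\<alpha> \<in> params T" "\<beta> \<in> params T"
    and proper: "tg_colon T Q \<alpha> y \<beta> z \<noteq> carrier T"
  shows "tg_semiprime T (tg_colon T Q \<alpha> y \<beta> z)"
proof -
  have I: "tg_ideal T Q"
    using Q by (simp add: tg_semiprime_def)
  have "t \<in> tg_colon T Q \<alpha> y \<beta> z"
    if t: "t \<in> carrier T" "\<gamma> \<in> params T" "\<delta> \<in> params T"
      and cube: "tprod T t \<gamma> t \<delta> t \<in> tg_colon T Q \<alpha> y \<beta> z" for t \<gamma> \<delta>
  proof -
    let ?w = "tprod T t \<alpha> y \<beta> z"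
    have "tprod T (tprod T t \<gamma> t \<delta> t) \<alpha> y \<beta> z \<in> Q"
      using cube by (simp add: tg_colon_def)
    then have "tprod T ?w \<gamma> ?w \<delta> ?w \<in> Q"
      using tprod_cube_colon t yz par tg_idealD(4)[OF I] tprod_closed by simp
    then have "?w \<in> Q"
      using Q t yz par tprod_closed unfolding tg_semiprime_def by blast
    then show ?thesis
      using t by (simp add: tg_colon_def)
  qed
  then show ?thesis
    using tg_ideal_colon[OF I yz par] proper unfolding tg_semiprime_def by blast
qed

section \<open>Separating points by prime ideals\<close>

lemma maximal_semiprime_avoiding_is_prime:
  assumes P: "tg_semiprime T P" and a: "a \<in> carrier T" "a \<notin> P"
    and maximal: "\<And>J. \<lbrakk>tg_semiprime T J; P \<subseteq> J; a \<notin> J\<rbrakk> \<Longrightarrow> J = P"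
  shows "tg_prime T P"
proof -
  have I: "tg_ideal T P"
    using P by (simp add: tg_semiprime_def)
  have exchange: "tprod T a \<alpha> y \<beta> z \<in> P"
    if "tprod T x \<alpha> y \<beta> z \<in> P" "x \<notin> P" "x \<in> carrier T" "y \<in> carrier T" "z \<in> carrier T"
      "\<alpha> \<in> params T" "\<beta> \<in> params T" for x y z \<alpha> \<beta>
  proof (rule ccontr)
    let ?C = "tg_colon T P \<alpha> y \<beta> z"
    assume "tprod T a \<alpha> y \<beta> z \<notin> P"
    then have "a \<notin> ?C"
      by (simp add: tg_colon_def)
    \<comment> \<open>The point \<open>a\<close> of the carrier witnesses that the colon is
      proper.\<close>
    moreover have "tg_semiprime T ?C"
      using tg_semiprime_colon[OF P that(4-7)] \<open>a \<notin> ?C\<close> a(1) by blast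
    ultimately have "?C = P"
      using maximal tg_subset_colon[OF I that(4-7)] by blast
    \<comment> \<open>The colon contains \<open>x\<close>, which is outside
      \<open>P\<close>.\<close>
    then show False
      using that by (auto simp: tg_colon_def)
  qed
  have "x \<in> P \<or> y \<in> P \<or> z \<in> P"
    if prod: "tprod T x \<alpha> y \<beta> z \<in> P"
      and car: "x \<in> carrier T" "y \<in> carrier T" "z \<in> carrier T" "\<alpha> \<in> params T" "\<beta> \<in> params T"
    for x y z \<alpha> \<beta>
  proof (rule ccontr)
    assume "\<not> ?thesis"
    then have "x \<notin> P" "y \<notin> P" "z \<notin> P"
      by auto
    have "tprod T a \<alpha> y \<beta> z \<in> P"
      using exchange[OF prod \<open>x \<notin> P\<close>] car by simp
    \<comment> \<open>Since \<open>exchange\<close> replaces only the first factor, \<open>y\<close>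
      and later \<open>z\<close> are brought to the front. The first move swaps
      \<open>\<alpha>\<close> and \<open>\<beta>\<close>, hence their order in the final
      cube.\<close>
    then have "tprod T y \<beta> a \<alpha> z \<in> P"
      using tprod_comm12[of a y z \<alpha> \<beta>] a car by simp
    then have "tprod T a \<beta> a \<alpha> z \<in> P"
      using exchange \<open>y \<notin> P\<close> a car by blast
    then have "tprod T z \<beta> a \<alpha> a \<in> P"
      using tprod_comm13[of a a z \<beta> \<alpha>] a car by simp
    then have "tprod T a \<beta> a \<alpha> a \<in> P"
      using exchange \<open>z \<notin> P\<close> a car by blast
    then show False
      using P a car unfolding tg_semiprime_def by blast
  qed
  then show ?thesis
    using P unfolding tg_prime_def tg_semiprime_def by blast
qed

lemma semiprime_separation:
  assumes Q: "tg_semiprime T Q" and a: "a \<in> carrier T" "a \<notin> Q"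
  obtains P where "tg_prime T P" "Q \<subseteq> P" "a \<notin> P"
proof -
  let ?A = "{P. tg_semiprime T P \<and> Q \<subseteq> P \<and> a \<notin> P}"
  have "\<Union>\<C> \<in> ?A" if "\<C> \<noteq> {}" "subset.chain ?A \<C>" for \<C>
  proof -
    have sub: "\<C> \<subseteq> ?A"
      using that(2) by (simp add: subset_chain_def)
    then have "a \<notin> \<Union>\<C>" "Q \<subseteq> \<Union>\<C>"
      using that(1) by blast+
    moreover have "tg_semiprime T (\<Union>\<C>)"
      \<comment> \<open>The union is proper because it still omits \<open>a\<close>.\<close>
      using that(2,1) by (rule tg_semiprime_Union_chain) (use a \<open>a \<notin> \<Union>\<C>\<close> in auto)
    ultimately show ?thesis
      by simp
  qed
  moreover have "?A \<noteq> {}"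
    using Q a by blast
  ultimately obtain P where P: "P \<in> ?A" and maximal: "\<forall>J\<in>?A. P \<subseteq> J \<longrightarrow> J = P"
    using subset_Zorn_nonempty[of ?A] by blast
  have "tg_prime T P"
  proof (rule maximal_semiprime_avoiding_is_prime)
    \<comment> \<open>Such a \<open>J\<close> contains \<open>Q\<close> through \<open>P\<close>, so
      it belongs to the family on which \<open>P\<close> is maximal.\<close>
    show "J = P" if "tg_semiprime T J" "P \<subseteq> J" "a \<notin> J" for J
      using P maximal that by blast
  qed (use P a in auto)
  then show thesis
    using that P by blast
qed

end

text \<open>For a cube the three alternatives of primeness coincide, so every prime above
  \<open>I\<close> contains the root. The carrier is excluded since it is a radical ideal but not
  semiprime.\<close>

lemma tg_radical_ideal_imp_semiprime:
  assumes I: "tg_radical_ideal T I" and proper: "I \<noteq> carrier T"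
  shows "tg_semiprime T I"
proof -
  have ideal: "tg_ideal T I" and rad: "I = tg_radical T I"
    using I by (auto simp: tg_radical_ideal_def)
  have "a \<in> I"
    if "a \<in> carrier T" "\<alpha> \<in> params T" "\<beta> \<in> params T" "tprod T a \<alpha> a \<beta> a \<in> I" for a \<alpha> \<beta>
  proof -
    have "a \<in> P" if "tg_prime T P" "I \<subseteq> P" for P
      using that \<open>a \<in> carrier T\<close> \<open>\<alpha> \<in> params T\<close> \<open>\<beta> \<in> params T\<close> \<open>tprod T a \<alpha> a \<beta> a \<in> I\<close>
      unfolding tg_prime_def by blast
    then have "a \<in> tg_radical T I"
      using \<open>a \<in> carrier T\<close> by (simp add: tg_radical_def)
    then show ?thesis
      using rad by simp
  qed
  then show ?thesis
    using ideal proper by (simp add: tg_semiprime_def)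
qed

lemma (in comm_ternary_gamma_semiring) semiprime_eq_radical:
  assumes "tg_semiprime T Q"
  shows "Q = tg_radical T Q"
proof
  have "Q \<subseteq> carrier T"
    using assms tg_idealD(1) unfolding tg_semiprime_def by blast
  then show "Q \<subseteq> tg_radical T Q"
    unfolding tg_radical_def by blast
  \<comment> \<open>A point of the radical lies in the carrier by definition, so if it were outside
    \<open>Q\<close> a prime above \<open>Q\<close> would omit it.\<close>
  show "tg_radical T Q \<subseteq> Q"
    using semiprime_separation[OF assms] unfolding tg_radical_def by blast
qed

theorem proposition5p7:
  fixes T :: "('a, 'g, 'm) ternary_gamma_scheme"
  assumes "comm_ternary_gamma_semiring T"
  shows "(\<forall>I. tg_radical_ideal T I \<and> I \<noteq> carrier T \<longrightarrow> tg_semiprime T I) \<and>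
         (\<forall>Q. tg_semiprime T Q \<longrightarrow> Q = tg_radical T Q)"
  using tg_radical_ideal_imp_semiprime
    comm_ternary_gamma_semiring.semiprime_eq_radical[OF assms] by blast

end
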